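(* There exists a holomorphic function $f$ defined on the unit disc $\mathbb{D}=\{z\in\mathbb{C}:|z|<1\}$, which does not extend holomorphically across $\partial\mathbb{D}$, such that the graph $\Gamma_f=\{(z,f(z)):z\in\mathbb{D}\}$ is not complete pluripolar in $\mathbb{C}^2$.
   Context: A set $E\subset\mathbb{C}^2$ is called complete pluripolar in $\mathbb{C}^2$ if there exists a plurisubharmonic function $u$ on $\mathbb{C}^2$ such that $E=\{z\in\mathbb{C}^2: u(z)=-\infty\}$. That $f$ does not extend holomorphically across $\partial\mathbb{D}$ means that $\mathbb{D}$ is the domain of existence of $f$, i.e. for every $z_0\in\mathbb{D}$ the Taylor series of $f$ at $z_0$ has radius of convergence equal to $\operatorname{dist}(z_0,\partial\mathbb{D})$. *)

theory Defs
  imports "HOL-Complex_Analysis.Complex_Analysis"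
begin

definition upper_semicontinuous_on :: "'a::topological_space set \<Rightarrow> ('a \<Rightarrow> ereal) \<Rightarrow> bool" where
  "upper_semicontinuous_on S u \<longleftrightarrow> (\<forall>c. openin (top_of_set S) {z \<in> S. u z < c})"

(* The library has no integral of extended real functions, so the integral is the difference of
   those of the positive and negative parts (e2ennreal maps negative values to 0). For u upper
   semicontinuous and < \<infinity> on the circle, the first of these is finite, so the difference is
   never \<infinity> - \<infinity>; the mean may be -\<infinity>. *)
definition circle_mean :: "(complex \<Rightarrow> ereal) \<Rightarrow> complex \<Rightarrow> real \<Rightarrow> ereal" where
  "circle_mean u c r =
     (enn2ereal (\<integral>\<^sup>+ t\<in>{0..2*pi}. e2ennreal (u (c + of_real r * cis t)) \<partial>lborel)
      - enn2ereal (\<integral>\<^sup>+ t\<in>{0..2*pi}. e2ennreal (- u (c + of_real r * cis t)) \<partial>lborel))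
     / ereal (2 * pi)"

(* The function that is identically -\<infinity> counts as subharmonic here, which is what restrictions
   of plurisubharmonic functions to complex lines need. *)
definition subharmonic_on :: "complex set \<Rightarrow> (complex \<Rightarrow> ereal) \<Rightarrow> bool" where
  "subharmonic_on S u \<longleftrightarrow>
     open S \<and> (\<forall>z\<in>S. u z < \<infinity>) \<and> upper_semicontinuous_on S u \<and>
     (\<forall>c r. 0 < r \<and> cball c r \<subseteq> S \<longrightarrow> u c \<le> circle_mean u c r)"

definition complex_line :: "complex \<times> complex \<Rightarrow> complex \<times> complex \<Rightarrow> complex \<Rightarrow> complex \<times> complex" where
  "complex_line a b \<zeta> = (fst a + \<zeta> * fst b, snd a + \<zeta> * snd b)"

(* As is usual in pluripotential theory, a plurisubharmonic function must not be identically
   -\<infinity> on any connected component of its domain. *)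
definition plurisubharmonic_on ::
    "(complex \<times> complex) set \<Rightarrow> (complex \<times> complex \<Rightarrow> ereal) \<Rightarrow> bool" where
  "plurisubharmonic_on S u \<longleftrightarrow>
     open S \<and> (\<forall>z\<in>S. u z < \<infinity>) \<and> upper_semicontinuous_on S u \<and>
     (\<forall>C\<in>components S. \<exists>z\<in>C. u z \<noteq> -\<infinity>) \<and>
     (\<forall>a b. subharmonic_on (complex_line a b -` S) (u \<circ> complex_line a b))"

definition complete_pluripolar :: "(complex \<times> complex) set \<Rightarrow> bool" where
  "complete_pluripolar E \<longleftrightarrow> (\<exists>u. plurisubharmonic_on UNIV u \<and> E = {z. u z = -\<infinity>})"

(* The distance to the boundary is an infimum in ereal, so that it is \<infinity> for D = UNIV,
   where infdist would give 0. *)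
definition is_domain_of_existence :: "complex set \<Rightarrow> (complex \<Rightarrow> complex) \<Rightarrow> bool" where
  "is_domain_of_existence D f \<longleftrightarrow>
     (\<forall>z0\<in>D. fps_conv_radius (fps_expansion f z0) = (INF w\<in>frontier D. ereal (dist z0 w)))"

definition graph_on :: "complex set \<Rightarrow> (complex \<Rightarrow> complex) \<Rightarrow> (complex \<times> complex) set" where
  "graph_on D f = {(z, f z) | z. z \<in> D}"

end

theory Submission
  imports Defs
begin

text \<open>
  The function is a Wolff--Denjoy series \<open>f z = (\<Sum>j. c\<^sub>j / (z - a\<^sub>j))\<close> whose poles
  \<open>a\<^sub>j\<close> are dense in the unit circle and whose positive coefficients \<open>c\<^sub>j\<close> decay extremely
  fast. Along the radius that ends at a pole \<open>a\<^sub>k\<close>, the term with the pole dominates all others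
  together, so \<open>f\<close> is unbounded near every point of the circle and has no holomorphic extension.

  Fix a point \<open>b\<close> of the circle that is not one of the countably many poles. The coefficients are
  so small that the series also converges at \<open>b\<close>. Then every plurisubharmonic \<open>u\<close> that is
  \<open>-\<infinity>\<close> on the graph of \<open>f\<close> over the disc is \<open>-\<infinity>\<close> at \<open>(b, f b)\<close> as well, which is
  not a point of that graph; so the graph is not complete pluripolar. The reason is a two-constants
  argument. The partial sums, corrected by a constant so that they take the value \<open>f b\<close> at \<open>b\<close>,
  are rational functions \<open>g\<close>. Outside tiny discs around the poles they are bounded uniformly,
  hence so is \<open>u (z, g z)\<close> from above, and over the circle \<open>\<bar>z\<bar> = 1/2\<close> they are so close to \<open>f\<close>
  that \<open>u (z, g z)\<close> is as negative as desired. The small discs have so little logarithmic capacity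
  that they do not shield \<open>b\<close> from that circle: an explicit combination of logarithms, the
  \<open>barrier\<close>, is bounded below by a positive constant at \<open>b\<close> but nonpositive on the discs and on
  \<open>\<bar>z\<bar> = 2\<close>. A maximum principle for \<open>u (z, g z)\<close> plus a multiple of the barrier therefore bounds
  \<open>u (b, f b)\<close> by an arbitrarily negative number.

  Plurisubharmonicity is defined by complex lines, whereas \<open>z \<mapsto> (z, g z)\<close> is a curve. Instead of
  proving that \<open>z \<mapsto> u (z, g z)\<close> is subharmonic, which would need regularisation of \<open>u\<close>,
  lemma \<open>plurisubharmonic_max_principle_along_graph\<close> obtains the maximum principle directly: it
  maximises \<open>u\<close> minus a large multiple of \<open>\<bar>w - g z\<bar>\<^sup>2\<close> over a tube around the graph and uses the
  complex line through the maximum that is parallel to the tangent of the graph. Along this line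
  \<open>w - g z\<close> is holomorphic with vanishing derivative at the maximum, so the Laplacian of the
  penalty vanishes there.
\<close>

section \<open>Circle means and holomorphic majorants\<close>

lemma circle_mean_mono:
  assumes "0 < r" "\<And>z. z \<in> sphere c r \<Longrightarrow> u z \<le> v z"
  shows "circle_mean u c r \<le> circle_mean v c r"
proof -
  have uv: "u (c + of_real r * cis t) \<le> v (c + of_real r * cis t)" for t
    using assms by (auto simp: dist_norm norm_mult)
  show ?thesis
    unfolding circle_mean_def
    by (intro ereal_divide_right_mono ereal_minus_mono nn_integral_mono mult_right_mono e2ennreal_mono
        less_eq_ennreal.rep_eq[THEN iffD1]) (use uv in auto)
qed

lemma circle_mean_continuous:
  fixes \<phi> :: "complex \<Rightarrow> real"
  assumes cont: "continuous_on (sphere c r) \<phi>" and "0 < r"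
    and I: "((\<lambda>t. \<phi> (c + of_real r * cis t)) has_integral I) {0..2 * pi}"
  shows "circle_mean (\<lambda>z. ereal (\<phi> z)) c r = ereal (I / (2 * pi))"
proof -
  define \<psi> where "\<psi> t = \<phi> (c + of_real r * cis t)" for t
  have cont\<psi>: "continuous_on {0..2 * pi} \<psi>"
    unfolding \<psi>_def using \<open>0 < r\<close>
    by (intro continuous_on_compose2[OF cont] continuous_intros) (auto simp: dist_norm norm_mult)
  have part: "\<exists>J\<ge>0. ((\<lambda>t. max 0 (k t)) has_integral J) {0..2 * pi} \<and>
      (\<integral>\<^sup>+ t\<in>{0..2*pi}. e2ennreal (ereal (k t)) \<partial>lborel) = ennreal J"
    if "continuous_on {0..2 * pi} k" for k
  proof -
    have "(\<lambda>t. max 0 (k t)) integrable_on {0..2 * pi}"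
      by (intro integrable_continuous_real continuous_intros that)
    then obtain J where J: "((\<lambda>t. max 0 (k t)) has_integral J) {0..2 * pi}"
      by (auto simp: integrable_on_def)
    have "(\<integral>\<^sup>+ t. ennreal (max 0 (k t)) * indicator {0..2 * pi} t \<partial>lborel) = ennreal J"
      by (rule nn_integral_has_integral_lebesgue'[OF _ J]) auto
    moreover have "J \<ge> 0"
      using J by (rule has_integral_nonneg) auto
    ultimately show ?thesis
      using J by (auto simp: ennreal_max_0 e2ennreal_ereal)
  qed
  obtain J1 where J1: "J1 \<ge> 0" "((\<lambda>t. max 0 (\<psi> t)) has_integral J1) {0..2 * pi}"
      "(\<integral>\<^sup>+ t\<in>{0..2*pi}. e2ennreal (ereal (\<psi> t)) \<partial>lborel) = ennreal J1"
    using part[OF cont\<psi>] by blast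
  obtain J2 where J2: "J2 \<ge> 0" "((\<lambda>t. max 0 (- \<psi> t)) has_integral J2) {0..2 * pi}"
      "(\<integral>\<^sup>+ t\<in>{0..2*pi}. e2ennreal (ereal (- \<psi> t)) \<partial>lborel) = ennreal J2"
    using part[OF continuous_on_minus[OF cont\<psi>]] by blast
  have "((\<lambda>t. max 0 (\<psi> t) - max 0 (- \<psi> t)) has_integral (J1 - J2)) {0..2 * pi}"
    by (intro has_integral_diff J1 J2)
  moreover have "(\<lambda>t. max 0 (\<psi> t) - max 0 (- \<psi> t)) = \<psi>"
    by (auto simp: fun_eq_iff max_def)
  ultimately have "J1 - J2 = I"
    using I unfolding \<psi>_def[symmetric] by (metis (no_types) has_integral_unique)
  then show ?thesis
    using J1 J2 unfolding circle_mean_def \<psi>_def by (auto simp: enn2ereal_ennreal)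
qed

lemma has_integral_circle_Re_holomorphic:
  assumes "0 < r" "continuous_on (cball c r) Q" "Q holomorphic_on ball c r"
  shows "((\<lambda>t. Re (Q (c + of_real r * cis t))) has_integral (2 * pi * Re (Q c))) {0..2 * pi}"
proof -
  have "((\<lambda>u. Q u / (u - c)) has_contour_integral (2 * of_real pi * \<i> * Q c))
      (part_circlepath c r 0 (2 * pi))"
    using Cauchy_integral_circlepath[OF assms(2,3), of c] \<open>0 < r\<close> by (simp add: circlepath_def)
  then have "((\<lambda>t. Q (c + of_real r * cis t) / (of_real r * cis t) * of_real r * \<i> * cis t)
      has_integral (2 * of_real pi * \<i> * Q c)) {0..2 * pi}"
    by (subst (asm) has_contour_integral_part_circlepath_iff) auto
  then have "((\<lambda>t. \<i> * Q (c + of_real r * cis t)) has_integral (2 * of_real pi * \<i> * Q c)) {0..2 * pi}"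
    using \<open>0 < r\<close> by (simp add: mult.commute)
  from has_integral_Im[OF this] show ?thesis
    by simp
qed

text \<open>
  All that the proof uses of the sub-mean value inequality, freed of the integrals of positive and
  negative parts: by Cauchy's formula the mean of \<open>Re Q\<close> over the circle is its value at the centre.
\<close>

lemma subharmonic_on_le_Re_holomorphic:
  assumes v: "subharmonic_on S v" and r: "0 < r" "cball c r \<subseteq> S"
    and Q: "continuous_on (cball c r) Q" "Q holomorphic_on ball c r"
    and le: "\<And>z. z \<in> sphere c r \<Longrightarrow> v z \<le> ereal (Re (Q z))"
  shows "v c \<le> ereal (Re (Q c))"
proof -
  have "v c \<le> circle_mean v c r"
    using v r by (auto simp: subharmonic_on_def)
  also have "\<dots> \<le> circle_mean (\<lambda>z. ereal (Re (Q z))) c r"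
    by (rule circle_mean_mono[OF \<open>0 < r\<close> le])
  also have "\<dots> = ereal (2 * pi * Re (Q c) / (2 * pi))"
    by (rule circle_mean_continuous[OF _ \<open>0 < r\<close> has_integral_circle_Re_holomorphic[OF \<open>0 < r\<close> Q]])
       (auto intro!: continuous_intros continuous_on_subset[OF Q(1)])
  finally show ?thesis
    by simp
qed

section \<open>Upper semicontinuous functions on compact sets\<close>

text \<open>
  If no value were maximal, the relatively open sets on which \<open>\<Psi>\<close> is below one of its values would
  cover \<open>K\<close>; but a finite subfamily misses the point that gives the largest of its bounds.
\<close>

lemma upper_semicontinuous_on_attains_max:
  fixes \<Psi> :: "'a::topological_space \<Rightarrow> ereal"
  assumes "compact K" "K \<noteq> {}" "upper_semicontinuous_on K \<Psi>"
  shows "\<exists>x\<in>K. \<forall>y\<in>K. \<Psi> y \<le> \<Psi> x"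
proof (rule ccontr)
  assume no_max: "\<not> ?thesis"
  define U where "U y = {z \<in> K. \<Psi> z < \<Psi> y}" for y
  have "\<forall>c\<in>U ` K. openin (top_of_set K) c"
    using assms(3) by (auto simp: upper_semicontinuous_on_def U_def)
  moreover have "K \<subseteq> \<Union> (U ` K)"
    using no_max by (force simp: U_def not_le)
  ultimately obtain D where "D \<subseteq> U ` K" "finite D" "K \<subseteq> \<Union> D"
    using \<open>compact K\<close> by (metis compact_eq_openin_cover)
  then obtain F where F: "F \<subseteq> K" "finite F" "K \<subseteq> \<Union> (U ` F)"
    by (metis finite_subset_image)
  then have "F \<noteq> {}"
    using \<open>K \<noteq> {}\<close> by auto
  then have "Max (\<Psi> ` F) \<in> \<Psi> ` F"
    using F(2) by simp
  then obtain y where "y \<in> F" "Max (\<Psi> ` F) = \<Psi> y"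
    by blast
  then have y: "y \<in> F" "\<forall>y'\<in>F. \<Psi> y' \<le> \<Psi> y"
    using F(2) by (auto simp flip: \<open>Max (\<Psi> ` F) = \<Psi> y\<close>)
  then obtain y' where "y' \<in> F" "\<Psi> y < \<Psi> y'"
    using F unfolding U_def by blast
  then show False
    using y by force
qed

lemma upper_semicontinuous_on_compose_add:
  fixes k :: "'a::topological_space \<Rightarrow> real"
  assumes u: "upper_semicontinuous_on UNIV u" and \<phi>: "continuous_on K \<phi>" and k: "continuous_on K k"
  shows "upper_semicontinuous_on K (\<lambda>x. u (\<phi> x) + ereal (k x))"
  unfolding upper_semicontinuous_on_def
proof
  fix c
  have "{x \<in> K. u (\<phi> x) + ereal (k x) < c} =
      (\<Union>b::real. (K \<inter> \<phi> -` {z. u z < ereal b}) \<inter> (K \<inter> k -` {y. ereal (y + b) < c}))" (is "_ = ?R")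
  proof (intro equalityI subsetI)
    fix x assume x: "x \<in> {x \<in> K. u (\<phi> x) + ereal (k x) < c}"
    then have "u (\<phi> x) < c - ereal (k x)"
      by (cases "u (\<phi> x)"; cases c) auto
    then obtain b where "u (\<phi> x) < ereal b" "ereal b < c - ereal (k x)"
      using ereal_dense2 by blast
    then show "x \<in> ?R"
      using x by (intro UN_I[of b]) (cases c; auto)+
  next
    fix x assume "x \<in> ?R"
    then obtain b where "x \<in> K" "u (\<phi> x) < ereal b" "ereal (k x + b) < c"
      by auto
    then show "x \<in> {x \<in> K. u (\<phi> x) + ereal (k x) < c}"
      by (cases "u (\<phi> x)"; cases c) auto
  qed
  moreover have "openin (top_of_set K) ?R"
  proof (rule openin_Union, clarify, rule openin_Int)
    fix b :: real
    show "openin (top_of_set K) (K \<inter> \<phi> -` {z. u z < ereal b})"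
      using u by (intro continuous_openin_preimage_gen[OF \<phi>]) (auto simp: upper_semicontinuous_on_def)
    show "openin (top_of_set K) (K \<inter> k -` {y. ereal (y + b) < c})"
      by (intro continuous_openin_preimage_gen[OF k] open_Collect_less continuous_intros)
  qed
  ultimately show "openin (top_of_set K) {x \<in> K. u (\<phi> x) + ereal (k x) < c}"
    by simp
qed

lemma upper_semicontinuous_bounded_above:
  assumes "upper_semicontinuous_on UNIV u" "\<And>x. u x < \<infinity>" "compact K"
  shows "\<exists>C::real. \<forall>x\<in>K. u x \<le> ereal C"
proof (cases "K = {}")
  case False
  have "upper_semicontinuous_on K (\<lambda>x. u x + ereal 0)"
    by (rule upper_semicontinuous_on_compose_add[OF assms(1) continuous_on_id]) auto
  from upper_semicontinuous_on_attains_max[OF assms(3) False this]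
  obtain x0 where "\<And>y. y \<in> K \<Longrightarrow> u y \<le> u x0"
    by auto
  moreover obtain C :: real where "u x0 < ereal C"
    using ereal_dense2[OF assms(2)] by blast
  ultimately show ?thesis
    by (meson less_imp_le order_trans)
qed auto

section \<open>A maximum principle along holomorphic graphs\<close>

text \<open>
  For smooth \<open>h\<close>, being touched from below by a harmonic function plus \<open>\<kappa> \<bar>z - p\<bar>\<^sup>2\<close> forces the
  Laplacian at \<open>p\<close> to be at least \<open>4 \<kappa>\<close>; the definition says this without derivatives or means.
  The harmonic function is given as a real part because it will be absorbed into a holomorphic majorant.
\<close>

definition strictly_subharmonic_at :: "real \<Rightarrow> (complex \<Rightarrow> real) \<Rightarrow> complex \<Rightarrow> bool" where
  "strictly_subharmonic_at \<kappa> h p \<longleftrightarrow>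
     (\<exists>\<delta>>0. \<exists>q. q holomorphic_on ball p \<delta> \<and> Re (q p) = h p \<and>
        (\<forall>z\<in>ball p \<delta>. Re (q z) + \<kappa> * (cmod (z - p))\<^sup>2 \<le> h z))"

text \<open>
  \<open>\<Omega>\<close> plays the part of the interior of \<open>L\<close>. The bound on the rest of \<open>L\<close> is required
  on a tube of radius \<open>\<sigma>\<close> around the graph because the maximum of the penalised function need not lie
  on the graph itself. At a maximum \<open>(p, g p + d)\<close> above \<open>B\<close>, with \<open>d\<close> small, the line
  \<open>\<zeta> \<mapsto> (p + \<zeta>, g p + d + \<zeta> g' p)\<close> has the displacement \<open>d + e \<zeta>\<close> from the graph in the second
  coordinate, where \<open>e\<close> is holomorphic and \<open>o(\<bar>\<zeta>\<bar>)\<close>. So the penalty is harmonic in \<open>\<zeta>\<close> up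
  to \<open>o(\<bar>\<zeta>\<bar>\<^sup>2)\<close>, and the strictness of \<open>h\<close> contradicts the mean value inequality.
\<close>

lemma plurisubharmonic_max_principle_along_graph:
  assumes psh: "plurisubharmonic_on UNIV u"
    and "compact L" "open \<Omega>" "\<Omega> \<subseteq> L"
    and g: "continuous_on L g" "g holomorphic_on \<Omega>"
    and h: "continuous_on L h" and "0 < \<kappa>"
    and strict: "\<And>p. p \<in> \<Omega> \<Longrightarrow> strictly_subharmonic_at \<kappa> h p"
    and "0 < \<sigma>"
    and bd: "\<And>z w. z \<in> L - \<Omega> \<Longrightarrow> cmod (w - g z) \<le> \<sigma> \<Longrightarrow> u (z, w) + ereal (h z) \<le> ereal B"
    and "z \<in> L"
  shows "u (z, g z) + ereal (h z) \<le> ereal B"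
proof (rule ccontr)
  assume above: "\<not> ?thesis"
  have usc: "upper_semicontinuous_on UNIV u" and fin: "\<And>x. u x < \<infinity>"
    and line: "\<And>a b. subharmonic_on UNIV (u \<circ> complex_line a b)"
    using psh by (auto simp: plurisubharmonic_on_def)
  define T where "T = L \<times> cball (0::complex) \<sigma>"
  have T: "compact T" "(z, 0) \<in> T" "T \<noteq> {}"
    using \<open>compact L\<close> \<open>z \<in> L\<close> \<open>0 < \<sigma>\<close> by (auto simp: T_def intro!: compact_Times)
  have gfst: "continuous_on T (\<lambda>x. g (fst x))" and hfst: "continuous_on T (\<lambda>x. h (fst x))"
    by (auto intro!: continuous_on_compose2[OF g(1)] continuous_on_compose2[OF h] continuous_intros simp: T_def)
  have cont: "continuous_on T (\<lambda>x. (fst x, g (fst x) + snd x))"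
    by (intro continuous_intros gfst)
  from upper_semicontinuous_bounded_above[OF usc fin compact_continuous_image[OF cont T(1)]]
  obtain C :: real where C: "\<And>x. x \<in> T \<Longrightarrow> u (fst x, g (fst x) + snd x) \<le> ereal C"
    by auto
  obtain H where H: "\<And>x. x \<in> L \<Longrightarrow> h x \<le> H"
    using compact_imp_bounded[OF compact_continuous_image[OF h \<open>compact L\<close>]]
    unfolding bounded_iff by (metis abs_le_D1 imageI real_norm_def)
  \<comment> \<open>With this factor the penalty alone keeps the maximum off the lateral boundary of the tube.\<close>
  define A where "A = (\<bar>C\<bar> + \<bar>H\<bar> + \<bar>B\<bar>) / \<sigma>\<^sup>2"
  have A: "A \<ge> 0" "C + H - A * \<sigma>\<^sup>2 \<le> B"
    using \<open>0 < \<sigma>\<close> by (auto simp: A_def)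
  define \<Psi> where "\<Psi> x = u (fst x, g (fst x) + snd x) + ereal (h (fst x) - A * (cmod (snd x))\<^sup>2)" for x
  have "upper_semicontinuous_on T \<Psi>"
    unfolding \<Psi>_def by (intro upper_semicontinuous_on_compose_add[OF usc cont] continuous_intros hfst)
  from upper_semicontinuous_on_attains_max[OF T(1,3) this]
  obtain p d where pd: "p \<in> L" "cmod d \<le> \<sigma>" and max: "\<And>y. y \<in> T \<Longrightarrow> \<Psi> y \<le> \<Psi> (p, d)"
    by (auto simp: T_def)
  have "\<Psi> (z, 0) > ereal B"
    using above by (simp add: \<Psi>_def)
  then have gtB: "\<Psi> (p, d) > ereal B"
    using max[OF T(2)] by simp
  obtain u0 where u0: "u (p, g p + d) = ereal u0"
    using gtB fin[of "(p, g p + d)"] by (cases "u (p, g p + d)") (auto simp: \<Psi>_def)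
  define m where "m = u0 + h p - A * (cmod d)\<^sup>2"
  have m: "\<Psi> (p, d) = ereal m" "m > B"
    using gtB by (auto simp: \<Psi>_def u0 m_def)
  have "p \<in> \<Omega>"
  proof (rule ccontr)
    assume "p \<notin> \<Omega>"
    then have "u0 + h p \<le> B"
      using bd[of p "g p + d"] pd u0 by auto
    then show False
      using m(2) A(1) by (simp add: m_def) (smt (verit) mult_nonneg_nonneg zero_le_power2)
  qed
  have "cmod d < \<sigma>"
  proof (rule ccontr)
    assume "\<not> cmod d < \<sigma>"
    then have "cmod d = \<sigma>"
      using pd by simp
    moreover have "u0 \<le> C"
      using C[of "(p, d)"] pd by (simp add: T_def u0)
    ultimately show False
      using A(2) H[OF \<open>p \<in> L\<close>] m(2) by (simp add: m_def)
  qed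
  obtain \<delta>1 q where \<delta>1: "\<delta>1 > 0" and q: "q holomorphic_on ball p \<delta>1" "Re (q p) = h p"
      "\<And>z. z \<in> ball p \<delta>1 \<Longrightarrow> Re (q z) + \<kappa> * (cmod (z - p))\<^sup>2 \<le> h z"
    using strict[OF \<open>p \<in> \<Omega>\<close>] unfolding strictly_subharmonic_at_def by blast
  obtain \<delta>2 where \<delta>2: "\<delta>2 > 0" "ball p \<delta>2 \<subseteq> \<Omega>"
    using \<open>open \<Omega>\<close> \<open>p \<in> \<Omega>\<close> by (auto simp: open_contains_ball)
  \<comment> \<open>The error \<open>\<bar>e \<zeta>\<bar> \<le> \<tau> \<bar>\<zeta>\<bar>\<close> may use up half of the strictness \<open>\<kappa>\<close>.\<close>
  define \<tau> where "\<tau> = sqrt (\<kappa> / (2 * (A + 1)))"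
  have "\<tau> > 0" and \<tau>2: "A * \<tau>\<^sup>2 \<le> \<kappa> / 2"
    using \<open>0 < \<kappa>\<close> A(1) by (auto simp: \<tau>_def field_simps)
  define g' where "g' = deriv g p"
  have "(g has_field_derivative g') (at p)"
    using g(2) \<open>open \<Omega>\<close> \<open>p \<in> \<Omega>\<close> by (simp add: g'_def holomorphic_derivI)
  then have "(g has_derivative (*) g') (at p)"
    by (simp add: has_field_derivative_def)
  then obtain \<delta>3 where \<delta>3: "\<delta>3 > 0"
      "\<And>y. cmod (y - p) < \<delta>3 \<Longrightarrow> cmod (g y - g p - g' * (y - p)) \<le> \<tau> * cmod (y - p)"
    using \<open>\<tau> > 0\<close> unfolding has_derivative_at_alt by blast
  define s where "s = min (min \<delta>1 \<delta>2) (min \<delta>3 ((\<sigma> - cmod d) / \<tau>))"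
  have "0 < s" "s \<le> \<delta>1" "s \<le> \<delta>2" "s \<le> \<delta>3" "s \<le> (\<sigma> - cmod d) / \<tau>"
    using \<delta>1 \<delta>2(1) \<delta>3(1) \<open>\<tau> > 0\<close> \<open>cmod d < \<sigma>\<close> by (simp_all add: s_def)
  moreover define r where "r = s / 2"
  ultimately have r: "0 < r" "r < \<delta>1" "r < \<delta>2" "r < \<delta>3" and "r \<le> (\<sigma> - cmod d) / \<tau>"
    by linarith+
  then have r\<sigma>: "cmod d + \<tau> * r \<le> \<sigma>"
    using \<open>\<tau> > 0\<close> by (simp add: field_simps)
  define e where "e \<zeta> = g p + \<zeta> * g' - g (p + \<zeta>)" for \<zeta>
  \<comment> \<open>By maximality \<open>u\<close> is at most \<open>Re Q\<close> on the circle, but \<open>Re Q\<close> at the centre is less than \<open>u0\<close>.\<close>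
  define Q where "Q \<zeta> = complex_of_real (m + A * (cmod d)\<^sup>2 - \<kappa> / 2 * r\<^sup>2) - q (p + \<zeta>)
     + complex_of_real (2 * A) * (cnj d * e \<zeta>)" for \<zeta>
  have sub: "p + \<zeta> \<in> ball p \<delta>1" "p + \<zeta> \<in> \<Omega>" if "\<zeta> \<in> cball 0 r" for \<zeta>
    using that r \<delta>2(2) by (auto simp: dist_norm subset_iff)
  have holQ: "Q holomorphic_on cball 0 r"
  proof -
    have "(\<lambda>\<zeta>. q (p + \<zeta>)) holomorphic_on cball 0 r"
      by (rule holomorphic_on_compose_gen[OF _ q(1), of "(+) p", unfolded o_def])
         (use sub in \<open>force intro: holomorphic_intros\<close>)+
    moreover have "(\<lambda>\<zeta>. g (p + \<zeta>)) holomorphic_on cball 0 r"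
      by (rule holomorphic_on_compose_gen[OF _ g(2), of "(+) p", unfolded o_def])
         (use sub in \<open>force intro: holomorphic_intros\<close>)+
    ultimately show ?thesis
      unfolding Q_def e_def by (intro holomorphic_intros)
  qed
  have "(u \<circ> complex_line (p, g p + d) (1, g')) 0 \<le> ereal (Re (Q 0))"
  proof (rule subharmonic_on_le_Re_holomorphic[OF line])
    fix \<zeta> :: complex assume "\<zeta> \<in> sphere 0 r"
    then have \<zeta>: "cmod \<zeta> = r"
      by simp
    have e: "cmod (e \<zeta>) \<le> \<tau> * r"
    proof -
      have "e \<zeta> = - (g (p + \<zeta>) - g p - g' * ((p + \<zeta>) - p))"
        by (simp add: e_def mult.commute)
      then show ?thesis
        using \<delta>3(2)[of "p + \<zeta>"] \<zeta> r by (simp add: norm_minus_commute)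
    qed
    have \<zeta>L: "p + \<zeta> \<in> L"
      using sub(2)[of \<zeta>] \<open>\<Omega> \<subseteq> L\<close> \<zeta> by auto
    have "(p + \<zeta>, d + e \<zeta>) \<in> T"
      using \<zeta>L norm_triangle_ineq[of d "e \<zeta>"] e r\<sigma> by (auto simp: T_def)
    from max[OF this] have "u (p + \<zeta>, g (p + \<zeta>) + (d + e \<zeta>)) + ereal (h (p + \<zeta>) - A * (cmod (d + e \<zeta>))\<^sup>2)
        \<le> ereal m"
      unfolding m(1) by (simp add: \<Psi>_def)
    moreover have "g (p + \<zeta>) + (d + e \<zeta>) = g p + d + \<zeta> * g'"
      by (simp add: e_def)
    ultimately have "u (p + \<zeta>, g p + d + \<zeta> * g') + ereal (h (p + \<zeta>) - A * (cmod (d + e \<zeta>))\<^sup>2) \<le> ereal m"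
      by (simp only:)
    then have "u (p + \<zeta>, g p + d + \<zeta> * g') \<le> ereal (m - h (p + \<zeta>) + A * (cmod (d + e \<zeta>))\<^sup>2)"
      by (cases "u (p + \<zeta>, g p + d + \<zeta> * g')") auto
    also have "m - h (p + \<zeta>) + A * (cmod (d + e \<zeta>))\<^sup>2 \<le> Re (Q \<zeta>)"
    proof -
      have 1: "Re (q (p + \<zeta>)) + \<kappa> * r\<^sup>2 \<le> h (p + \<zeta>)"
        using q(3)[of "p + \<zeta>"] \<zeta> r by (simp add: dist_norm)
      have 2: "(cmod (d + e \<zeta>))\<^sup>2 = (cmod d)\<^sup>2 + 2 * Re (cnj d * e \<zeta>) + (cmod (e \<zeta>))\<^sup>2"
        unfolding cmod_power2 by (simp add: power2_eq_square algebra_simps)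
      have "A * (cmod (e \<zeta>))\<^sup>2 \<le> A * (\<tau> * r)\<^sup>2"
        using A(1) e by (intro mult_left_mono power_mono) auto
      also have "\<dots> = (A * \<tau>\<^sup>2) * r\<^sup>2"
        by (simp add: power_mult_distrib)
      also have "\<dots> \<le> (\<kappa> / 2) * r\<^sup>2"
        by (intro mult_right_mono \<tau>2) auto
      finally have 3: "A * (cmod (e \<zeta>))\<^sup>2 \<le> (\<kappa> / 2) * r\<^sup>2" .
      have 4: "Re (Q \<zeta>) = m + A * (cmod d)\<^sup>2 - \<kappa> / 2 * r\<^sup>2 - Re (q (p + \<zeta>)) + 2 * A * Re (cnj d * e \<zeta>)"
        by (simp add: Q_def)
      show ?thesis
        unfolding 2 4 using 1 3 by (simp add: algebra_simps)
    qed
    finally show "(u \<circ> complex_line (p, g p + d) (1, g')) \<zeta> \<le> ereal (Re (Q \<zeta>))"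
      by (simp add: complex_line_def)
  qed (use r holomorphic_on_imp_continuous_on[OF holQ] holomorphic_on_subset[OF holQ ball_subset_cball] in auto)
  moreover have "Re (Q 0) = u0 - \<kappa> / 2 * r\<^sup>2"
    by (simp add: Q_def e_def q(2) m_def)
  ultimately have "\<kappa> / 2 * r\<^sup>2 \<le> 0"
    by (simp add: complex_line_def u0)
  moreover have "\<kappa> / 2 * r\<^sup>2 > 0"
    using \<open>0 < \<kappa>\<close> r by simp
  ultimately show False
    by linarith
qed

section \<open>A series of poles dense in the unit circle\<close>

locale boundary_poles =
  fixes a :: "nat \<Rightarrow> complex" and b :: complex
  assumes norm_a: "cmod (a j) = 1"
    and inj_a: "inj a"
    and dense_a: "cmod \<zeta> = 1 \<Longrightarrow> 0 < e \<Longrightarrow> \<exists>j. dist (a j) \<zeta> < e"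
    and norm_b: "cmod b = 1"
    and b_not_pole: "a j \<noteq> b"
begin

text \<open>
  Scaled so that the potential \<open>\<Sum>j. weight j * ln (4 / \<bar>z - a j\<bar>)\<close>, which is infinite at the poles,
  equals \<open>ln 2 / 2\<close> at \<open>b\<close>. The numerator 4 keeps every term nonnegative on \<open>cball 0 2\<close>.
\<close>

definition weight :: "nat \<Rightarrow> real" where
  "weight j = ln 2 / (2 ^ (j + 2) * (ln 4 - ln (cmod (b - a j))))"

text \<open>
  The radius of a disc around \<open>a j\<close> on which the \<open>j\<close>-th term of the potential is at least
  \<open>ln 4\<close>, and which does not contain \<open>b\<close> in its interior.
\<close>

definition hole :: "nat \<Rightarrow> real" where
  "hole j = min (cmod (b - a j)) (4 * exp (- ln 4 / weight j))"

definition residue_at :: "nat \<Rightarrow> real" where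
  "residue_at j = hole j / 2 ^ (j + 1)"

definition partial_sum :: "nat \<Rightarrow> complex \<Rightarrow> complex" where
  "partial_sum N z = (\<Sum>j<N. of_real (residue_at j) / (z - a j))"

definition pole_series :: "complex \<Rightarrow> complex" where
  "pole_series z = (\<Sum>j. of_real (residue_at j) / (z - a j))"

lemma dist_b: "0 < cmod (b - a j)" "cmod (b - a j) \<le> 2" "0 < ln 4 - ln (cmod (b - a j))"
proof -
  show pos: "0 < cmod (b - a j)"
    using b_not_pole[of j] by auto
  show le: "cmod (b - a j) \<le> 2"
    using norm_triangle_ineq4[of b "a j"] norm_a[of j] norm_b by simp
  have "ln (cmod (b - a j)) \<le> ln 2"
    using pos le by simp
  also have "\<dots> < ln (4::real)"
    by simp
  finally show "0 < ln 4 - ln (cmod (b - a j))"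
    by simp
qed

lemma weight_pos: "0 < weight j"
  using dist_b by (simp add: weight_def)

lemma weight_at_b: "weight j * (ln 4 - ln (cmod (b - a j))) = ln 2 / 2 ^ (j + 2)"
  using dist_b(3)[of j] by (simp add: weight_def)

lemma hole_pos: "0 < hole j"
  using dist_b by (simp add: hole_def)

lemma hole_le: "hole j \<le> cmod (b - a j)"
  by (simp add: hole_def)

lemma weight_at_hole: "ln 4 \<le> weight j * (ln 4 - ln (hole j))"
proof -
  have "ln (hole j) \<le> ln (4 * exp (- ln 4 / weight j))"
    using hole_pos by (intro ln_mono) (auto simp: hole_def)
  also have "\<dots> = ln 4 - ln 4 / weight j"
    by (simp add: ln_mult)
  finally have "ln 4 / weight j \<le> ln 4 - ln (hole j)"
    by simp
  then show ?thesis
    using weight_pos[of j] by (simp add: field_simps)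
qed

lemma residue_at_pos: "0 < residue_at j"
  using hole_pos by (simp add: residue_at_def)

lemma residue_at_le: "residue_at j \<le> (1 / 2) ^ j"
  using hole_le[of j] dist_b(2)[of j] by (simp add: residue_at_def field_simps)

lemma norm_term_outside_holes:
  assumes "hole j \<le> cmod (z - a j)"
  shows "cmod (of_real (residue_at j) / (z - a j)) \<le> (1 / 2) ^ Suc j"
proof -
  have "cmod (of_real (residue_at j) / (z - a j)) = residue_at j / cmod (z - a j)"
    using residue_at_pos[of j] by (simp add: norm_divide)
  also have "\<dots> \<le> residue_at j / hole j"
    using assms residue_at_pos[of j] hole_pos[of j] by (intro frac_le) auto
  also have "\<dots> = (1 / 2) ^ Suc j"
    using hole_pos[of j] by (simp add: residue_at_def field_simps)
  finally show ?thesis .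
qed

lemma norm_partial_sum_outside_holes:
  assumes "\<And>j. j < N \<Longrightarrow> hole j \<le> cmod (z - a j)"
  shows "cmod (partial_sum N z) \<le> 1"
proof -
  have "cmod (partial_sum N z) \<le> (\<Sum>j<N. (1 / 2) ^ Suc j)"
    unfolding partial_sum_def by (intro sum_norm_le norm_term_outside_holes assms) auto
  also have "\<dots> \<le> (\<Sum>j. (1 / 2) ^ Suc j)"
    using power_half_series by (intro sum_le_suminf) (auto simp: sums_iff)
  also have "\<dots> = 1"
    using power_half_series by (simp add: sums_iff)
  finally show ?thesis .
qed

lemma partial_sum_at_b: "(\<lambda>N. partial_sum N b) \<longlonglongrightarrow> pole_series b"
proof -
  have "summable (\<lambda>j. of_real (residue_at j) / (b - a j))"
    by (rule summable_comparison_test'[OF sums_summable[OF power_half_series]])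
       (rule norm_term_outside_holes[OF hole_le])
  then show ?thesis
    unfolding partial_sum_def pole_series_def by (rule summable_LIMSEQ)
qed

lemma uniform_limit_partial_sum:
  assumes "r < 1"
  shows "uniform_limit (cball 0 r) partial_sum pole_series sequentially"
proof -
  have "cmod (of_real (residue_at j) / (z - a j)) \<le> (1 / 2) ^ j / (1 - r)" if "z \<in> cball 0 r" for j z
  proof -
    have "1 - r \<le> cmod (z - a j)"
      using that norm_triangle_ineq2[of "a j" z] norm_a[of j] by (simp add: norm_minus_commute)
    then show ?thesis
      using residue_at_le[of j] residue_at_pos[of j] assms by (auto simp: norm_divide intro!: frac_le)
  qed
  moreover have "summable (\<lambda>j. (1 / 2) ^ j / (1 - r))"
    by (intro summable_divide summable_geometric) auto
  ultimately show ?thesis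
    unfolding partial_sum_def pole_series_def by (rule Weierstrass_m_test)
qed

lemma holomorphic_pole_series: "pole_series holomorphic_on ball 0 1"
proof (rule holomorphic_uniform_sequence)
  show "partial_sum N holomorphic_on ball 0 1" for N
    unfolding partial_sum_def using norm_a by (intro holomorphic_intros) force
  fix x :: complex assume x: "x \<in> ball 0 1"
  define d where "d = (1 - cmod x) / 2"
  have "cmod z \<le> (1 + cmod x) / 2" if "z \<in> cball x d" for z
    using that norm_triangle_ineq2[of z x] by (simp add: d_def dist_norm norm_minus_commute field_simps)
  then have sub: "cball x d \<subseteq> cball 0 ((1 + cmod x) / 2)"
    by auto
  have "uniform_limit (cball x d) partial_sum pole_series sequentially"
    by (rule uniform_limit_on_subset[OF uniform_limit_partial_sum sub]) (use x in auto)
  moreover have "0 < d" "cball x d \<subseteq> ball 0 1"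
    using x sub by (auto simp: d_def subset_iff)
  ultimately show "\<exists>d>0. cball x d \<subseteq> ball 0 1 \<and> uniform_limit (cball x d) partial_sum pole_series sequentially"
    by blast
qed auto

text \<open>
  On the radius, \<open>1 - t\<close> is at most the distance to any pole, so the rescaled terms are dominated by
  the summable coefficients, and by Tannery's theorem only the term with the pole \<open>a k\<close> survives.
\<close>

lemma pole_series_radial_limit:
  "((\<lambda>t. of_real (1 - t) * pole_series (of_real t * a k)) \<longlongrightarrow> - of_real (residue_at k) / a k) (at_left 1)"
proof -
  define s where "s j t = complex_of_real (1 - t) * (of_real (residue_at j) / (of_real t * a k - a j))" for j t
  define l where "l j = (if j = k then - of_real (residue_at j) / a j else 0)" for j
  have a0: "a j \<noteq> 0" for j
    using norm_a[of j] by auto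
  have near: "eventually (\<lambda>t::real. 0 < t \<and> t < 1) (at_left 1)"
    by (intro eventually_conj eventually_at_left_real[of 0 1, THEN eventually_mono]) auto
  have lim: "(s j \<longlongrightarrow> l j) (at_left 1)" for j
  proof (cases "j = k")
    case True
    have "eventually (\<lambda>t. s j t = l j) (at_left 1)"
      using near
    proof eventually_elim
      case (elim t)
      have "of_real t * a k - a k = - (of_real (1 - t) * a k)"
        by (simp add: algebra_simps)
      then show ?case
        using elim a0[of k] by (simp add: s_def l_def True)
    qed
    then show ?thesis
      by (rule tendsto_eventually)
  next
    case False
    then have "a k \<noteq> a j"
      using inj_a by (auto dest: injD)
    then have "(s j \<longlongrightarrow> complex_of_real (1 - 1) * (of_real (residue_at j) / (of_real 1 * a k - a j))) (at_left 1)"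
      unfolding s_def by (intro tendsto_intros) auto
    then show ?thesis
      using False by (simp add: l_def)
  qed
  have bound: "norm (s j t) \<le> residue_at j" if t: "0 < t" "t < 1" for j t
  proof -
    have "1 - t \<le> cmod (of_real t * a k - a j)"
      using norm_triangle_ineq2[of "a j" "of_real t * a k"] t norm_a
      by (simp add: norm_mult norm_minus_commute)
    then have "(1 - t) * residue_at j \<le> residue_at j * cmod (of_real t * a k - a j)"
      using residue_at_pos[of j] by (simp add: mult.commute)
    moreover have "0 < cmod (of_real t * a k - a j)"
      using \<open>1 - t \<le> _\<close> t by linarith
    ultimately have "(1 - t) * residue_at j / cmod (of_real t * a k - a j) \<le> residue_at j"
      by (simp add: pos_divide_le_eq)
    moreover have "norm (s j t) = (1 - t) * residue_at j / cmod (of_real t * a k - a j)"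
      using t residue_at_pos[of j] by (simp add: s_def norm_mult norm_divide del: of_real_diff)
    ultimately show ?thesis
      by simp
  qed
  have "eventually (\<lambda>(j, t). norm (s j t) \<le> residue_at j) (at_top \<times>\<^sub>F at_left 1)"
    using eventually_compose_filterlim[OF near filterlim_snd]
    by (rule eventually_mono) (auto simp: case_prod_unfold intro: bound)
  moreover have "summable residue_at"
    by (rule summable_comparison_test'[where N = 0 and g = "\<lambda>j. (1 / 2) ^ j"])
       (use residue_at_le residue_at_pos in \<open>auto simp: abs_of_pos\<close>)
  ultimately have lim_sum: "((\<lambda>t. \<Sum>j. s j t) \<longlongrightarrow> (\<Sum>j. l j)) (at_left 1)"
    using tannerys_theorem[of s l "at_left 1" residue_at, OF lim] by simp
  have sum_l: "(\<Sum>j. l j) = - of_real (residue_at k) / a k"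
    unfolding l_def using sums_single[of k "\<lambda>j. - of_real (residue_at j) / a j"] by (rule sums_unique[symmetric])
  have "eventually (\<lambda>t. (\<Sum>j. s j t) = of_real (1 - t) * pole_series (of_real t * a k)) (at_left 1)"
    using near
  proof eventually_elim
    case (elim t)
    have "summable (\<lambda>j. s j t)"
      by (rule summable_comparison_test'[OF \<open>summable residue_at\<close>, of 0]) (use bound elim in auto)
    then have "summable (\<lambda>j. of_real (residue_at j) / (of_real t * a k - a j))"
      using elim unfolding s_def by (subst (asm) summable_cmult_iff) auto
    then show ?case
      unfolding s_def pole_series_def by (rule suminf_mult)
  qed
  from Lim_transform_eventually[OF lim_sum this] show ?thesis
    unfolding sum_l .
qed

text \<open>
  A Taylor series converging on a larger disc would continue \<open>pole_series\<close> boundedly to a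
  neighbourhood of some \<open>a k\<close>, against the nonzero limit of the rescaled radial values.
\<close>

lemma pole_series_not_extendable:
  assumes "z0 \<in> ball 0 1" "cmod \<zeta> = 1"
  shows "fps_conv_radius (fps_expansion pole_series z0) \<le> ereal (dist z0 \<zeta>)"
proof (rule ccontr)
  define F where "F = fps_expansion pole_series z0"
  assume "\<not> ?thesis"
  then obtain R where R: "dist z0 \<zeta> < R" "ereal R < fps_conv_radius F"
    unfolding F_def not_le using ereal_dense2 by (metis ereal_less_eq(3) less_ereal.simps(1))
  obtain k where k: "dist (a k) \<zeta> < R - dist z0 \<zeta>"
    using dense_a[OF assms(2)] R(1) by (metis diff_gt_0_iff_gt)
  then have ak: "a k \<in> ball z0 R"
    using dist_triangle[of z0 "a k" \<zeta>] by (simp add: dist_commute)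
  define G where "G z = eval_fps F (z - z0)" for z
  have holG: "G holomorphic_on ball z0 R"
    unfolding G_def
  proof (rule holomorphic_on_compose_gen[OF _ holomorphic_on_eval_fps[OF order_refl], unfolded o_def])
    show "(\<lambda>z. z - z0) holomorphic_on ball z0 R"
      by (intro holomorphic_intros)
    have "ereal (dist z0 z) < fps_conv_radius F" if "dist z0 z < R" for z
      using that R(2) order.strict_trans[of "ereal (dist z0 z)" "ereal R"] by simp
    then show "(\<lambda>z. z - z0) ` ball z0 R \<subseteq> eball 0 (fps_conv_radius F)"
      by (auto simp: dist_norm norm_minus_commute)
  qed
  define S where "S = ball 0 1 \<inter> ball z0 R"
  have eq: "pole_series z = G z" if "z \<in> S" for z
  proof (rule analytic_continuation_open[where s = "ball z0 (min R (1 - cmod z0))" and s' = S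
        and f = pole_series and g = G])
    have "0 < R"
      using R(1) zero_le_dist[of z0 \<zeta>] by linarith
    then show "ball z0 (min R (1 - cmod z0)) \<noteq> {}"
      using assms(1) by simp
    have "w \<in> ball 0 1" if "w \<in> ball z0 (1 - cmod z0)" for w
      using that norm_triangle_ineq2[of w z0] by (simp add: dist_norm norm_minus_commute)
    then have sub: "ball z0 (1 - cmod z0) \<subseteq> ball 0 1"
      by blast
    then show "ball z0 (min R (1 - cmod z0)) \<subseteq> S"
      by (auto simp: S_def)
    show "connected S"
      unfolding S_def by (intro convex_connected convex_Int convex_ball)
    show "pole_series holomorphic_on S" "G holomorphic_on S"
      using holomorphic_pole_series holG by (auto simp: S_def elim!: holomorphic_on_subset)
    show "pole_series w = G w" if "w \<in> ball z0 (min R (1 - cmod z0))" for w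
    proof -
      have "pole_series holomorphic_on eball z0 (ereal (1 - cmod z0))"
        using holomorphic_on_subset[OF holomorphic_pole_series sub] by simp
      from eval_fps_expansion[OF this, of w] that show ?thesis
        by (simp add: G_def F_def)
    qed
  qed (use that in \<open>auto simp: S_def\<close>)
  have contG: "isCont G (a k)"
    using holomorphic_on_imp_continuous_on[OF holG] ak by (simp add: continuous_on_eq_continuous_at)
  have "((\<lambda>t. of_real t * a k) \<longlongrightarrow> of_real 1 * a k) (at_left 1)"
    by (intro tendsto_intros)
  then have lim: "((\<lambda>t. of_real t * a k) \<longlongrightarrow> a k) (at_left 1)"
    by simp
  have "((\<lambda>t. complex_of_real (1 - t) * G (of_real t * a k)) \<longlongrightarrow> complex_of_real (1 - 1) * G (a k)) (at_left 1)"
    by (intro tendsto_intros isCont_tendsto_compose[OF contG lim])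
  moreover have "eventually (\<lambda>t. complex_of_real (1 - t) * G (of_real t * a k)
      = of_real (1 - t) * pole_series (of_real t * a k)) (at_left 1)"
  proof -
    have "eventually (\<lambda>t::real. t \<in> {0<..<1}) (at_left 1)"
      by (rule eventually_at_left_real) auto
    moreover have "eventually (\<lambda>t. of_real t * a k \<in> ball z0 R) (at_left 1)"
      using topological_tendstoD[OF lim _ ak] by simp
    ultimately show ?thesis
    proof eventually_elim
      case (elim t)
      then have "of_real t * a k \<in> S"
        using norm_a[of k] by (simp add: S_def norm_mult)
      then show ?case
        using eq by simp
    qed
  qed
  ultimately have "((\<lambda>t. complex_of_real (1 - t) * pole_series (of_real t * a k)) \<longlongrightarrow> complex_of_real (1 - 1) * G (a k)) (at_left 1)"
    by (rule Lim_transform_eventually)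
  from tendsto_unique[OF trivial_limit_at_left_real this pole_series_radial_limit]
  have "- of_real (residue_at k) / a k = 0"
    by simp
  then show False
    using residue_at_pos[of k] norm_a[of k] by auto
qed

lemma domain_of_existence_pole_series: "is_domain_of_existence (ball 0 1) pole_series"
  unfolding is_domain_of_existence_def
proof
  fix z0 :: complex assume z0: "z0 \<in> ball 0 1"
  have fr: "frontier (ball (0::complex) 1) = sphere 0 1"
    by (simp add: frontier_ball)
  have "w \<in> ball 0 1" if "w \<in> ball z0 (1 - cmod z0)" for w
    using that norm_triangle_ineq2[of w z0] by (simp add: dist_norm norm_minus_commute)
  then have "ball z0 (1 - cmod z0) \<subseteq> ball 0 1"
    by blast
  then have "pole_series holomorphic_on eball z0 (ereal (1 - cmod z0))"
    using holomorphic_on_subset[OF holomorphic_pole_series] by simp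
  then have ge: "ereal (1 - cmod z0) \<le> fps_conv_radius (fps_expansion pole_series z0)"
    by (rule conv_radius_fps_expansion)
  define \<zeta> where "\<zeta> = (if z0 = 0 then 1 else sgn z0)"
  have "dist z0 \<zeta> = 1 - cmod z0" and "cmod \<zeta> = 1"
  proof -
    show "cmod \<zeta> = 1"
      by (simp add: \<zeta>_def norm_sgn)
    have "z0 = of_real (cmod z0) * \<zeta>"
      by (simp add: \<zeta>_def sgn_eq)
    then have "z0 - \<zeta> = of_real (cmod z0 - 1) * \<zeta>"
      by (simp add: algebra_simps)
    then have "dist z0 \<zeta> = \<bar>cmod z0 - 1\<bar> * cmod \<zeta>"
      by (simp add: dist_norm norm_mult del: of_real_diff)
    then show "dist z0 \<zeta> = 1 - cmod z0"
      using z0 \<open>cmod \<zeta> = 1\<close> by simp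
  qed
  then have "(INF w\<in>sphere 0 1. ereal (dist z0 w)) \<le> ereal (1 - cmod z0)"
    by (intro INF_lower2[of \<zeta>]) auto
  with ge have "(INF w\<in>sphere 0 1. ereal (dist z0 w)) \<le> fps_conv_radius (fps_expansion pole_series z0)"
    by order
  moreover have "fps_conv_radius (fps_expansion pole_series z0) \<le> (INF w\<in>sphere 0 1. ereal (dist z0 w))"
    using pole_series_not_extendable[OF z0] by (intro INF_greatest) auto
  ultimately show "fps_conv_radius (fps_expansion pole_series z0) = (INF w\<in>frontier (ball 0 1). ereal (dist z0 w))"
    unfolding fr by order
qed

end

text \<open>
  A countable dense subset of the circle serves as the poles; being countable it misses some \<open>b\<close>.
\<close>

lemma boundary_poles_exist: "\<exists>a b. boundary_poles a b"
proof -
  obtain T where T: "countable T" "T \<subseteq> sphere (0::complex) 1" "sphere 0 1 \<subseteq> closure T"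
    using separable by blast
  have unc: "uncountable (sphere (0::complex) 1)"
    by (rule connected_uncountable[of _ 1 "-1"]) (auto intro: connected_sphere)
  have "infinite T"
  proof
    assume "finite T"
    then have "sphere 0 1 \<subseteq> T"
      using T(3) by (simp add: finite_imp_closed)
    then show False
      using unc \<open>finite T\<close> by (meson countable_finite finite_subset)
  qed
  obtain b where b: "b \<in> sphere 0 1" "b \<notin> T"
    using unc T(1) by (metis countable_subset subsetI)
  define a where "a = from_nat_into T"
  have bij: "bij_betw a UNIV T"
    unfolding a_def using T(1) \<open>infinite T\<close> by (rule bij_betw_from_nat_into)
  have aT: "a j \<in> T" for j
    using bij by (auto simp: bij_betw_def)
  have "boundary_poles a b"
  proof
    show "cmod (a j) = 1" "a j \<noteq> b" for j
      using aT[of j] T(2) b by auto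
    show "inj a" "cmod b = 1"
      using bij b by (auto simp: bij_betw_def)
    fix \<zeta> :: complex and e :: real assume "cmod \<zeta> = 1" "0 < e"
    then obtain w where "w \<in> T" "dist w \<zeta> < e"
      using T(3) by (auto simp: subset_iff closure_approachable)
    then show "\<exists>j. dist (a j) \<zeta> < e"
      using bij by (auto simp: bij_betw_def)
  qed
  then show ?thesis
    by blast
qed

section \<open>The barrier\<close>

lemma holomorphic_log_norm_on_ball:
  assumes "a \<notin> ball p \<delta>"
  shows "\<exists>l. l holomorphic_on ball p \<delta> \<and> (\<forall>z\<in>ball p \<delta>. Re (l z) = ln (cmod (z - a)))"
proof -
  have "(\<lambda>z. z - a) holomorphic_on ball p \<delta>"
    by (intro holomorphic_intros)
  moreover have "contractible (ball p \<delta>)"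
    by (intro convex_imp_contractible convex_ball)
  moreover have "z - a \<noteq> 0" if "z \<in> ball p \<delta>" for z
    using that assms by auto
  ultimately obtain l where l: "l holomorphic_on ball p \<delta>" "\<And>z. z \<in> ball p \<delta> \<Longrightarrow> z - a = exp (l z)"
    using contractible_imp_holomorphic_log by blast
  have "Re (l z) = ln (cmod (z - a))" if "z \<in> ball p \<delta>" for z
    using l(2)[OF that] by simp
  then show ?thesis
    using l(1) by blast
qed

lemma strictly_subharmonic_at_scale:
  assumes "strictly_subharmonic_at \<kappa> h p" "0 < M"
  shows "strictly_subharmonic_at (M * \<kappa>) (\<lambda>z. M * h z) p"
proof -
  obtain \<delta> q where q: "\<delta> > 0" "q holomorphic_on ball p \<delta>" "Re (q p) = h p"
      "\<forall>z\<in>ball p \<delta>. Re (q z) + \<kappa> * (cmod (z - p))\<^sup>2 \<le> h z"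
    using assms(1) unfolding strictly_subharmonic_at_def by blast
  have "M * Re (q z) + M * \<kappa> * (cmod (z - p))\<^sup>2 \<le> M * h z" if "z \<in> ball p \<delta>" for z
    using mult_left_mono[of "Re (q z) + \<kappa> * (cmod (z - p))\<^sup>2" "h z" M] q(4) that \<open>0 < M\<close>
    by (simp add: algebra_simps)
  then show ?thesis
    unfolding strictly_subharmonic_at_def using q
    by (intro exI[of _ \<delta>] conjI exI[of _ "\<lambda>z. of_real M * q z"] holomorphic_intros) auto
qed

context boundary_poles
begin

text \<open>
  Up to normalisation, a lower bound for the harmonic measure of the circle \<open>\<bar>z\<bar> = 1/2\<close> seen from
  \<open>z\<close> in the disc of radius 2 punctured by the holes. The quadratic term makes it strictly
  subharmonic; its factor is small enough to leave the value at \<open>b\<close> positive.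
\<close>

definition barrier :: "nat \<Rightarrow> complex \<Rightarrow> real" where
  "barrier N z = ln 2 - ln (cmod z) - (\<Sum>j<N. weight j * (ln 4 - ln (cmod (z - a j))))
     - (4 - (cmod z)\<^sup>2) / 24"

text \<open>
  Logarithms of distances are real parts of holomorphic functions, and \<open>\<bar>z\<bar>\<^sup>2\<close> differs from
  \<open>\<bar>z - p\<bar>\<^sup>2\<close> by the real part of an affine function.
\<close>

lemma barrier_strictly_subharmonic:
  assumes "p \<noteq> 0" "\<And>j. j < N \<Longrightarrow> p \<noteq> a j"
  shows "strictly_subharmonic_at (1 / 24) (barrier N) p"
proof -
  have "open (- insert 0 (a ` {..<N}))" "p \<in> - insert 0 (a ` {..<N})"
    using assms by (auto intro!: finite_imp_closed simp: open_Compl)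
  then obtain \<delta> where \<delta>: "\<delta> > 0" "ball p \<delta> \<subseteq> - insert 0 (a ` {..<N})"
    by (meson open_contains_ball)
  obtain l0 where l0: "l0 holomorphic_on ball p \<delta>" "\<forall>z\<in>ball p \<delta>. Re (l0 z) = ln (cmod (z - 0))"
    using holomorphic_log_norm_on_ball[of 0 p \<delta>] \<delta>(2) by blast
  have "\<exists>l. l holomorphic_on ball p \<delta> \<and> (\<forall>z\<in>ball p \<delta>. Re (l z) = ln (cmod (z - a j)))" if "j < N" for j
    using holomorphic_log_norm_on_ball[of "a j" p \<delta>] \<delta>(2) that by blast
  then obtain l where l: "\<And>j. j < N \<Longrightarrow> l j holomorphic_on ball p \<delta>"
      "\<And>j z. j < N \<Longrightarrow> z \<in> ball p \<delta> \<Longrightarrow> Re (l j z) = ln (cmod (z - a j))"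
    by metis
  define q where "q z = of_real (ln 2) - l0 z - (\<Sum>j<N. of_real (weight j) * (of_real (ln 4) - l j z))
     - (4 - of_real ((cmod p)\<^sup>2) - 2 * cnj p * (z - p)) / 24" for z
  have "q holomorphic_on ball p \<delta>"
    unfolding q_def using l0(1) l(1) by (intro holomorphic_intros) auto
  moreover have Re_q: "Re (q z) + (1 / 24) * (cmod (z - p))\<^sup>2 = barrier N z" if "z \<in> ball p \<delta>" for z
  proof -
    have "(cmod z)\<^sup>2 = (cmod p)\<^sup>2 + 2 * Re (cnj p * (z - p)) + (cmod (z - p))\<^sup>2"
      unfolding cmod_power2 by (simp add: power2_eq_square algebra_simps)
    moreover have "Re (q z) = ln 2 - Re (l0 z) - (\<Sum>j<N. weight j * (ln 4 - Re (l j z)))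
        - (4 - (cmod p)\<^sup>2 - 2 * Re (cnj p * (z - p))) / 24"
      by (simp add: q_def Re_divide_numeral)
    moreover have "(\<Sum>j<N. weight j * (ln 4 - Re (l j z))) = (\<Sum>j<N. weight j * (ln 4 - ln (cmod (z - a j))))"
      using l(2) that by (intro sum.cong) auto
    moreover have "Re (l0 z) = ln (cmod z)"
      using l0(2) that by simp
    ultimately show ?thesis
      by (simp add: barrier_def field_simps)
  qed
  moreover have "Re (q p) = barrier N p"
    using Re_q[of p] \<delta>(1) by simp
  ultimately show ?thesis
    unfolding strictly_subharmonic_at_def using \<delta>(1) by (intro exI[of _ \<delta>] conjI exI[of _ q]) auto
qed

text \<open>
  On \<open>cball 0 2\<close> the terms of the potential are nonnegative, so any of them may be dropped.
\<close>

lemma barrier_le: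
  assumes "cmod z \<le> 2" "J \<subseteq> {..<N}" "\<And>j. j < N \<Longrightarrow> z \<noteq> a j"
  shows "barrier N z \<le> ln 2 - ln (cmod z) - (\<Sum>j\<in>J. weight j * (ln 4 - ln (cmod (z - a j))))"
proof -
  have "0 \<le> weight j * (ln 4 - ln (cmod (z - a j)))" if "j < N" for j
  proof -
    have "0 < cmod (z - a j)" "cmod (z - a j) \<le> 4"
      using assms(3)[OF that] norm_triangle_ineq4[of z "a j"] norm_a[of j] assms(1) by auto
    then have "ln (cmod (z - a j)) \<le> ln 4"
      by simp
    then show ?thesis
      using weight_pos[of j] by simp
  qed
  then have "(\<Sum>j\<in>J. weight j * (ln 4 - ln (cmod (z - a j)))) \<le> (\<Sum>j<N. weight j * (ln 4 - ln (cmod (z - a j))))"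
    using assms(2) by (intro sum_mono2) auto
  moreover have "(cmod z)\<^sup>2 \<le> 2\<^sup>2"
    using assms(1) by (intro power_mono) auto
  moreover from this have "0 \<le> (4 - (cmod z)\<^sup>2) / 24"
    by simp
  ultimately show ?thesis
    unfolding barrier_def by linarith
qed

lemma barrier_at_b: "1 / 8 \<le> barrier N b"
proof -
  have "(\<Sum>j<N. weight j * (ln 4 - ln (cmod (b - a j)))) = (\<Sum>j<N. (ln 2 / 2) * (1 / 2) ^ Suc j)"
    by (intro sum.cong refl) (simp add: weight_at_b field_simps)
  also have "\<dots> = (ln 2 / 2) * (\<Sum>j<N. (1 / 2) ^ Suc j)"
    by (simp only: sum_distrib_left)
  also have "(\<Sum>j<N. (1 / 2 :: real) ^ Suc j) \<le> (\<Sum>j. (1 / 2) ^ Suc j)"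
    using sums_summable[OF power_half_series] by (rule sum_le_suminf) auto
  also have "\<dots> = 1"
    using power_half_series by (rule sums_unique[symmetric])
  finally have "(\<Sum>j<N. weight j * (ln 4 - ln (cmod (b - a j)))) \<le> ln 2 / 2"
    by simp
  moreover have "ln 2 \<ge> (1 / 2 :: real)"
    using ln_le_minus_one[of "1 / 2 :: real"] by (simp add: ln_div)
  ultimately show ?thesis
    by (simp add: barrier_def norm_b)
qed

section \<open>The graph is not complete pluripolar\<close>

text \<open>
  The maximum principle is applied to the bound \<open>C\<close>, which does not depend on the number
  \<open>N\<close> of poles taken into account. Since the barrier is at least \<open>1/8\<close> at \<open>b\<close>, a large multiple
  \<open>M\<close> of it lifts a finite value at \<open>(b, f b)\<close> above \<open>C\<close>; the price on \<open>\<bar>z\<bar> = 1/2\<close>, where the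
  barrier is at most \<open>ln 4\<close>, is paid by the values of \<open>u\<close> near the graph of \<open>f\<close>, taking \<open>N\<close>
  large enough.
\<close>

lemma plurisubharmonic_minus_infinity_at_b:
  assumes psh: "plurisubharmonic_on UNIV u"
    and minus_inf: "\<And>z. z \<in> ball 0 1 \<Longrightarrow> u (z, pole_series z) = -\<infinity>"
  shows "u (b, pole_series b) = -\<infinity>"
proof (rule ccontr)
  assume not_minus_inf: "u (b, pole_series b) \<noteq> -\<infinity>"
  have usc: "upper_semicontinuous_on UNIV u" and fin: "\<And>x. u x < \<infinity>"
    using psh by (auto simp: plurisubharmonic_on_def)
  obtain u1 where u1: "u (b, pole_series b) = ereal u1"
    using not_minus_inf fin[of "(b, pole_series b)"] by (cases "u (b, pole_series b)") auto
  \<comment> \<open>The radius 4 leaves room for \<open>\<bar>g z\<bar> \<le> 3\<close> and a tube of radius at most 1.\<close>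
  have "compact (cball 0 2 \<times> cball 0 4 :: (complex \<times> complex) set)"
    by (intro compact_Times compact_cball)
  from upper_semicontinuous_bounded_above[OF usc fin this] obtain C :: real
    where C: "\<And>x. x \<in> cball 0 2 \<times> cball 0 4 \<Longrightarrow> u x \<le> ereal C"
    by blast
  define M where "M = 8 * (\<bar>C - u1\<bar> + 1)"
  have "M * (1 / 8) = \<bar>C - u1\<bar> + 1"
    by (simp add: M_def)
  then have M: "M > 0" "u1 + M * (1 / 8) > C"
    by arith+
  define V where "V = {x. u x < ereal (C - M * ln 4)}"
  have "open V"
    using usc by (simp add: V_def upper_semicontinuous_on_def)
  have "compact ((\<lambda>z. (z, pole_series z)) ` sphere 0 (1 / 2))"
    by (intro compact_continuous_image continuous_intros compact_sphere
        continuous_on_subset[OF holomorphic_on_imp_continuous_on[OF holomorphic_pole_series]]) auto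
  moreover have "(\<lambda>z. (z, pole_series z)) ` sphere 0 (1 / 2) \<subseteq> V"
    using minus_inf by (auto simp: V_def)
  ultimately obtain \<sigma>0 where \<sigma>0: "\<sigma>0 > 0" "(\<Union>x\<in>(\<lambda>z. (z, pole_series z)) ` sphere 0 (1 / 2). ball x \<sigma>0) \<subseteq> V"
    using \<open>open V\<close> by (elim compact_subset_open_imp_ball_epsilon_subset)
  define \<sigma> where "\<sigma> = min 1 (\<sigma>0 / 4)"
  have \<sigma>: "0 < \<sigma>" "\<sigma> \<le> 1" "3 * \<sigma> < \<sigma>0"
    using \<sigma>0(1) by (auto simp: \<sigma>_def min_def)
  have "eventually (\<lambda>N. \<forall>z\<in>cball 0 (1 / 2). dist (partial_sum N z) (pole_series z) < \<sigma>) sequentially"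
    using uniform_limit_partial_sum[of "1 / 2"] \<sigma>(1) by (simp add: uniform_limit_iff)
  moreover have "eventually (\<lambda>N. dist (partial_sum N b) (pole_series b) < \<sigma>) sequentially"
    using partial_sum_at_b \<sigma>(1) by (rule tendstoD)
  ultimately have "eventually (\<lambda>N. (\<forall>z\<in>cball 0 (1 / 2). dist (partial_sum N z) (pole_series z) < \<sigma>) \<and>
      dist (partial_sum N b) (pole_series b) < \<sigma>) sequentially"
    by (rule eventually_conj)
  then obtain N where N: "\<And>z. z \<in> cball 0 (1 / 2) \<Longrightarrow> dist (partial_sum N z) (pole_series z) < \<sigma>"
      "dist (partial_sum N b) (pole_series b) < \<sigma>"
    unfolding eventually_sequentially by blast
  \<comment> \<open>Near \<open>(b, f b)\<close> the values of \<open>u\<close> may be far below the one at \<open>(b, f b)\<close>, so \<open>g b = f b\<close> has to hold exactly.\<close>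
  define g where "g z = partial_sum N z - partial_sum N b + pole_series b" for z
  define L where "L = cball 0 2 \<inter> {z. 1 / 2 \<le> cmod z} \<inter> (\<Inter>j\<in>{..<N}. {z. hole j \<le> cmod (z - a j)})"
  define \<Omega> where "\<Omega> = ball 0 2 \<inter> {z. 1 / 2 < cmod z} \<inter> (\<Inter>j\<in>{..<N}. {z. hole j < cmod (z - a j)})"
  have off: "z \<noteq> 0" "j < N \<Longrightarrow> z \<noteq> a j" if "z \<in> L" for z j
    using that hole_pos[of j] by (auto simp: L_def dest: bspec[of _ _ j])
  have "u (b, g b) + ereal (M * barrier N b) \<le> ereal C"
  proof (rule plurisubharmonic_max_principle_along_graph[OF psh, where L = L and \<Omega> = \<Omega>
        and g = g and h = "\<lambda>z. M * barrier N z" and \<kappa> = "M * (1 / 24)" and \<sigma> = \<sigma>])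
    show "compact L"
      unfolding L_def
      by (intro compact_Int_closed compact_cball closed_INT ballI closed_Collect_le continuous_intros)
    show "open \<Omega>"
      unfolding \<Omega>_def
      by (intro open_Int open_ball open_INT finite_lessThan ballI open_Collect_less continuous_intros)
    show "\<Omega> \<subseteq> L"
      by (force simp: \<Omega>_def L_def)
    have holg: "g holomorphic_on L"
      unfolding g_def partial_sum_def using off by (intro holomorphic_intros) auto
    then show "continuous_on L g" "g holomorphic_on \<Omega>"
      using \<open>\<Omega> \<subseteq> L\<close> by (auto intro: holomorphic_on_imp_continuous_on elim: holomorphic_on_subset)
    show "continuous_on L (\<lambda>z. M * barrier N z)"
      unfolding barrier_def using off by (intro continuous_intros) auto
    show "0 < M * (1 / 24)"
      using M(1) by simp
    show "strictly_subharmonic_at (M * (1 / 24)) (\<lambda>z. M * barrier N z) p" if "p \<in> \<Omega>" for p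
      using off[of p] that \<open>\<Omega> \<subseteq> L\<close> M(1)
      by (intro strictly_subharmonic_at_scale barrier_strictly_subharmonic) auto
    show "0 < \<sigma>"
      by (rule \<sigma>(1))
    have "hole j \<le> cmod (b - a j)" for j
      by (rule hole_le)
    then show "b \<in> L"
      by (auto simp: L_def norm_b)
    fix z w assume z: "z \<in> L - \<Omega>" and w: "cmod (w - g z) \<le> \<sigma>"
    have "z \<in> L" and z2: "cmod z \<le> 2" "1 / 2 \<le> cmod z"
      using z by (auto simp: L_def)
    note off = off[OF \<open>z \<in> L\<close>]
    have "ln (1 / 2) \<le> ln (cmod z)"
      using z2 by (intro ln_mono) auto
    then have ln_z: "- ln 2 \<le> ln (cmod z)"
      by (simp add: ln_div)
    have ln4: "ln 4 = 2 * ln (2::real)"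
      using ln_realpow[of "2::real" 2] by simp
    have u_C: "u (z, w) \<le> ereal C"
    proof -
      have "cmod (partial_sum N z) \<le> 1" "cmod (partial_sum N b) \<le> 1"
        using \<open>z \<in> L\<close> by (auto simp: L_def intro!: norm_partial_sum_outside_holes hole_le)
      moreover have "cmod (pole_series b) \<le> 1"
        by (rule Lim_norm_ubound[OF _ partial_sum_at_b])
           (auto intro!: always_eventually norm_partial_sum_outside_holes hole_le)
      ultimately have "cmod (g z) \<le> 3"
        using norm_triangle_ineq[of "partial_sum N z - partial_sum N b" "pole_series b"]
          norm_triangle_ineq4[of "partial_sum N z" "partial_sum N b"] by (simp add: g_def)
      then have "cmod w \<le> 4"
        using norm_triangle_ineq[of "w - g z" "g z"] w \<sigma>(2) by simp
      then show ?thesis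
        using C[of "(z, w)"] z2 by simp
    qed
    consider "cmod z = 1 / 2" | "barrier N z \<le> 0"
    proof -
      consider "cmod z = 2" | "cmod z = 1 / 2" | j where "j < N" "cmod (z - a j) = hole j"
        using z by (force simp: L_def \<Omega>_def)
      then show thesis
      proof cases
        case 1
        then show thesis
          using that(2) barrier_le[where N = N, OF z2(1) empty_subsetI off(2)] by simp
      next
        case 2
        then show thesis
          by (rule that(1))
      next
        case (3 j)
        then have "barrier N z \<le> ln 2 - ln (cmod z) - weight j * (ln 4 - ln (hole j))"
          using barrier_le[where N = N and J = "{j}", OF z2(1) _ off(2)] by simp
        then show thesis
          using that(2) weight_at_hole[of j] ln_z ln4 by simp
      qed
    qed
    then show "u (z, w) + ereal (M * barrier N z) \<le> ereal C"
    proof cases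
      case 1
      have "dist (partial_sum N z) (pole_series z) < \<sigma>"
        using N(1)[of z] 1 by simp
      then have "cmod (g z - pole_series z) < 2 * \<sigma>"
        using N(2) norm_triangle_ineq4[of "partial_sum N z - pole_series z" "partial_sum N b - pole_series b"]
        by (simp add: g_def dist_norm algebra_simps)
      then have "cmod (w - pole_series z) < \<sigma>0"
        using norm_triangle_ineq[of "w - g z" "g z - pole_series z"] w \<sigma>(3) by simp
      then have "(z, w) \<in> ball (z, pole_series z) \<sigma>0"
        by (simp add: dist_Pair_Pair dist_norm norm_minus_commute)
      then have "(z, w) \<in> V"
        using \<sigma>0(2) 1 by (force simp: subset_iff)
      then have "u (z, w) < ereal (C - M * ln 4)"
        by (simp add: V_def)
      moreover have "barrier N z \<le> ln 4"
        using barrier_le[where N = N, OF z2(1) empty_subsetI off(2)] ln_z ln4 by simp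
      then have "M * barrier N z \<le> M * ln 4"
        using M(1) by simp
      ultimately show ?thesis
        by (cases "u (z, w)") auto
    next
      case 2
      then have "M * barrier N z \<le> 0"
        using M(1) by (simp add: mult_nonneg_nonpos)
      then show ?thesis
        using u_C by (cases "u (z, w)") auto
    qed
  qed
  then have "u1 + M * barrier N b \<le> C"
    by (simp add: g_def u1)
  moreover have "M * (1 / 8) \<le> M * barrier N b"
    using barrier_at_b[of N] M(1) by (intro mult_left_mono) auto
  ultimately show False
    using M(2) by linarith
qed

lemma graph_pole_series_not_complete_pluripolar:
  "\<not> complete_pluripolar (graph_on (ball 0 1) pole_series)"
proof
  assume "complete_pluripolar (graph_on (ball 0 1) pole_series)"
  then obtain u where psh: "plurisubharmonic_on UNIV u"
    and u: "graph_on (ball 0 1) pole_series = {x. u x = -\<infinity>}"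
    by (auto simp: complete_pluripolar_def)
  have "u (b, pole_series b) = -\<infinity>"
    by (rule plurisubharmonic_minus_infinity_at_b[OF psh]) (use u in \<open>auto simp: graph_on_def\<close>)
  then have "(b, pole_series b) \<in> graph_on (ball 0 1) pole_series"
    using u by simp
  then show False
    using norm_b by (simp add: graph_on_def)
qed

end

theorem corollary1p2:
  shows "\<exists>f :: complex \<Rightarrow> complex.
           f holomorphic_on ball 0 1 \<and>
           is_domain_of_existence (ball 0 1) f \<and>
           \<not> complete_pluripolar (graph_on (ball 0 1) f)"
proof -
  obtain a b where "boundary_poles a b"
    using boundary_poles_exist by blast
  then interpret boundary_poles a b .
  show ?thesis
    using holomorphic_pole_series domain_of_existence_pole_series
      graph_pole_series_not_complete_pluripolar by blast
qed

end
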